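(* Let $\mathcal{K}=K\times I$ be a space-time prism, let $u\in H^{(s_t,s_s)}(\mathcal{K})$ and $\check u=u\circ G_{\mathcal{K}}$. There is a constant $C>0$ independent of $h_K$ and $\Delta t$ such that $$\|u\|^2_{\mathcal{K}}\le Ch_K^2\|\check u\|^2_{\check{\mathcal{K}}},\qquad \|\check u\|^2_{\check{\mathcal{K}}}\le Ch_K^{-2}\|u\|^2_{\mathcal{K}},\qquad \|\check u\|^2_{\mathcal{F}_{\check{\mathcal{K}}}}\le Ch_K^{-1}\|u\|^2_{\mathcal{F}_{\mathcal{K}}},$$ where $\mathcal{F}_{\check{\mathcal{K}}}$ is any lateral face of $\check{\mathcal{K}}$ and $\mathcal{F}_{\mathcal{K}}=G_{\mathcal{K}}(\mathcal{F}_{\check{\mathcal{K}}})$ is the corresponding lateral face of $\mathcal{K}$ (the last inequality being understood for $u$ with $L^2$ trace on $\mathcal{F}_{\mathcal{K}}$).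
   Context: $K$ is a triangle in $\mathbb{R}^2$, $I=(t_n,t_{n+1})$, $\Delta t=t_{n+1}-t_n$. Space-time points are written $(x_0,\boldsymbol{x})$ with $x_0\in I$ (time) and $\boldsymbol{x}\in K$. $\widehat K$ is the reference triangle with vertices $(0,0),(1,0),(0,1)$ and $H_K(\widehat{\boldsymbol{x}})=B_K\widehat{\boldsymbol{x}}+\boldsymbol{c}$ is an affine bijection $\widehat K\to K$. The intermediate prism is $\check{\mathcal{K}}=\widehat K\times I$ with coordinates $(\check x_0,\check{\boldsymbol{x}})$, and $G_{\mathcal{K}}:\check{\mathcal{K}}\to\mathcal{K}$ is $G_{\mathcal{K}}(\check x_0,\check{\boldsymbol{x}})=(\check x_0,B_K\check{\boldsymbol{x}}+\boldsymbol{c})$. Lateral faces of $\mathcal{K}$ are $e\times I$, with $e$ an edge of $K$ (similarly for $\check{\mathcal{K}}$). $h_K$ and $\rho_K$ are the radii of the circumscribed and inscribed circles of $K$; shape regularity $h_K/\rho_K\le c_r$ is assumed, with $c_r$ a fixed constant on which $C$ may depend. $\|\cdot\|_D$ is the $L^2(D)$ norm. $H^{(s_t,s_s)}(\mathcal{K})$ is the space of $v\in L^2(\mathcal{K})$ with $\partial_{x_0}^{\alpha_t}\partial_{x_1}^{\alpha_1}\partial_{x_2}^{\alpha_2}v\in L^2(\mathcal{K})$ for all $\alpha_t\le s_t$, $\alpha_1+\alpha_2\le s_s$. *)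

theory Defs
  imports "HOL-Analysis.Analysis"
begin

text \<open>Space-time points are pairs of a time and a point of the plane.\<close>

type_synonym spacetime = "real \<times> (real^2)"


subsection \<open>The space L2\<close>

definition L2 :: "'a measure \<Rightarrow> ('a \<Rightarrow> real) set" where
  "L2 M = {f. f \<in> borel_measurable M \<and> integrable M (\<lambda>x. (f x)\<^sup>2)}"

definition L2_norm :: "'a measure \<Rightarrow> ('a \<Rightarrow> real) \<Rightarrow> real" where
  "L2_norm M f = sqrt (LINT x|M. (f x)\<^sup>2)"


subsection \<open>Anisotropic Sobolev spaces\<close>

definition pderiv_dir :: "'a::euclidean_space \<Rightarrow> ('a \<Rightarrow> real) \<Rightarrow> 'a \<Rightarrow> real" where
  "pderiv_dir b f x = frechet_derivative f (at x) b"

text \<open>Infinitely differentiable: all iterated partial derivatives exist and are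
  (totally) differentiable everywhere, hence continuous.\<close>

definition smooth :: "('a::euclidean_space \<Rightarrow> real) \<Rightarrow> bool" where
  "smooth f \<longleftrightarrow>
     (\<forall>bs. set bs \<subseteq> Basis \<longrightarrow> (\<forall>x. (foldr pderiv_dir bs f) differentiable (at x)))"

definition test_functions :: "'a::euclidean_space set \<Rightarrow> ('a \<Rightarrow> real) set" where
  "test_functions S =
     {\<phi>. smooth \<phi> \<and> compact (closure {x. \<phi> x \<noteq> 0}) \<and> closure {x. \<phi> x \<noteq> 0} \<subseteq> S}"

definition mixed_deriv :: "nat \<Rightarrow> nat \<Rightarrow> nat \<Rightarrow> (spacetime \<Rightarrow> real) \<Rightarrow> spacetime \<Rightarrow> real" where
  "mixed_deriv \<alpha>t \<alpha>1 \<alpha>2 f =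
     (pderiv_dir (1, 0) ^^ \<alpha>t)
       ((pderiv_dir (0, axis 1 1) ^^ \<alpha>1) ((pderiv_dir (0, axis 2 1) ^^ \<alpha>2) f))"

definition weak_mixed_deriv ::
    "spacetime set \<Rightarrow> nat \<Rightarrow> nat \<Rightarrow> nat \<Rightarrow> (spacetime \<Rightarrow> real) \<Rightarrow> (spacetime \<Rightarrow> real) \<Rightarrow> bool" where
  "weak_mixed_deriv D \<alpha>t \<alpha>1 \<alpha>2 v w \<longleftrightarrow>
     (\<forall>\<phi> \<in> test_functions (interior D).
        (LINT x|lebesgue_on D. v x * mixed_deriv \<alpha>t \<alpha>1 \<alpha>2 \<phi> x)
          = (-1) ^ (\<alpha>t + \<alpha>1 + \<alpha>2) * (LINT x|lebesgue_on D. w x * \<phi> x))"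

definition sobolev :: "nat \<Rightarrow> nat \<Rightarrow> spacetime set \<Rightarrow> (spacetime \<Rightarrow> real) set" where
  "sobolev st ss D =
     {v \<in> L2 (lebesgue_on D).
        \<forall>\<alpha>t \<alpha>1 \<alpha>2. \<alpha>t \<le> st \<and> \<alpha>1 + \<alpha>2 \<le> ss \<longrightarrow>
          (\<exists>w \<in> L2 (lebesgue_on D). weak_mixed_deriv D \<alpha>t \<alpha>1 \<alpha>2 v w)}"


subsection \<open>Triangles and prisms\<close>

definition triangle :: "real^2 \<Rightarrow> real^2 \<Rightarrow> real^2 \<Rightarrow> (real^2) set" where
  "triangle a b c = convex hull {a, b, c}"

definition circumscribed_circle :: "real^2 \<Rightarrow> real^2 \<Rightarrow> real^2 \<Rightarrow> real^2 \<Rightarrow> real \<Rightarrow> bool" where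
  "circumscribed_circle a b c z r \<longleftrightarrow> {a, b, c} \<subseteq> sphere z r"

text \<open>The circle lies in the triangle and touches all three sides.\<close>

definition inscribed_circle :: "real^2 \<Rightarrow> real^2 \<Rightarrow> real^2 \<Rightarrow> real^2 \<Rightarrow> real \<Rightarrow> bool" where
  "inscribed_circle a b c z r \<longleftrightarrow>
     r > 0 \<and> cball z r \<subseteq> triangle a b c \<and>
     sphere z r \<inter> closed_segment a b \<noteq> {} \<and>
     sphere z r \<inter> closed_segment b c \<noteq> {} \<and>
     sphere z r \<inter> closed_segment c a \<noteq> {}"

definition ref_vertices :: "(real^2) set" where
  "ref_vertices = {vector [0, 0], vector [1, 0], vector [0, 1]}"

definition ref_triangle :: "(real^2) set" where
  "ref_triangle = convex hull ref_vertices"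

definition prism :: "real \<Rightarrow> real \<Rightarrow> (real^2) set \<Rightarrow> spacetime set" where
  "prism t0 t1 K = {t0<..<t1} \<times> K"

definition H_map :: "real^2^2 \<Rightarrow> real^2 \<Rightarrow> real^2 \<Rightarrow> real^2" where
  "H_map B d x = B *v x + d"

definition G_map :: "real^2^2 \<Rightarrow> real^2 \<Rightarrow> spacetime \<Rightarrow> spacetime" where
  "G_map B d y = (fst y, B *v snd y + d)"


subsection \<open>Lateral faces and their surface measure\<close>

text \<open>The lateral face over the edge with end points \<open>p\<close>, \<open>q\<close>.\<close>

definition lateral_face :: "real^2 \<Rightarrow> real^2 \<Rightarrow> real \<Rightarrow> real \<Rightarrow> spacetime set" where
  "lateral_face p q t0 t1 = prism t0 t1 (closed_segment p q)"

text \<open>Surface measure on the planar rectangle \<open>lateral_face p q t0 t1\<close> (\<open>p \<noteq> q\<close>): the image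
  of Lebesgue measure under the affine parametrization
  \<open>(t, s) \<mapsto> (t, p + s (q - p))\<close>, multiplied by its area factor \<open>dist p q\<close>.\<close>

definition face_measure :: "real^2 \<Rightarrow> real^2 \<Rightarrow> real \<Rightarrow> real \<Rightarrow> spacetime measure" where
  "face_measure p q t0 t1 =
     density
       (embed_measure (lebesgue_on ({t0<..<t1} \<times> {0..1}))
          (\<lambda>(t, s). (t, p + s *\<^sub>R (q - p))))
       (\<lambda>_. ennreal (dist p q))"

lemma space_face_measure: "space (face_measure p q t0 t1) = lateral_face p q t0 t1"
proof -
  have "(\<lambda>(t, s). (t, p + s *\<^sub>R (q - p))) ` ({t0<..<t1} \<times> {0..1})
      = {t0<..<t1} \<times> ((\<lambda>s. p + s *\<^sub>R (q - p)) ` {0..1})"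
    by force
  also have "(\<lambda>s. p + s *\<^sub>R (q - p)) ` {0..1} = closed_segment p q"
    by (simp add: closed_segment_image_interval algebra_simps)
  finally show ?thesis
    by (simp add: face_measure_def space_embed_measure lateral_face_def prism_def
        space_restrict_space)
qed

lemma G_map_lateral_face:
  "G_map B d ` lateral_face p q t0 t1 = lateral_face (H_map B d p) (H_map B d q) t0 t1"
proof -
  have "H_map B d ` closed_segment p q = (\<lambda>x. d + x) ` ((*v) B ` closed_segment p q)"
    by (auto simp: H_map_def add.commute)
  also have "\<dots> = closed_segment (H_map B d p) (H_map B d q)"
    by (simp only: H_map_def add.commute[of _ d] closed_segment_translation
        closed_segment_linear_image[OF matrix_vector_mul_linear])
  finally have *: "H_map B d ` closed_segment p q = closed_segment (H_map B d p) (H_map B d q)" .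
  have "G_map B d = map_prod id (H_map B d)"
    by (auto simp: G_map_def H_map_def fun_eq_iff)
  then show ?thesis
    by (simp add: lateral_face_def prism_def map_prod_image *)
qed


subsection \<open>Traces\<close>

text \<open>\<open>g\<close> is the trace of \<open>u\<close> (a function on \<open>D\<close>) with respect to the surface measure \<open>M\<close> of a
  part of the boundary of \<open>D\<close>: at almost every boundary point \<open>x\<close>,
  the mean of \<open>\<bar>u - g x\<bar>\<close> over \<open>D \<inter> ball x r\<close> tends to 0 as \<open>r \<rightarrow> 0\<close>.
  This is the definition of trace customary for functions of bounded variation. It makes sense
  for every locally integrable \<open>u\<close>, determines \<open>g\<close> almost everywhere, gives the restriction for
  functions continuous up to the boundary, and agrees with the Sobolev trace on lateral faces
  whenever \<open>u\<close> has weak spatial derivatives in L2.\<close>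

definition is_trace ::
    "spacetime set \<Rightarrow> spacetime measure \<Rightarrow> (spacetime \<Rightarrow> real) \<Rightarrow> (spacetime \<Rightarrow> real) \<Rightarrow> bool" where
  "is_trace D M u g \<longleftrightarrow>
     (AE x in M.
        ((\<lambda>r. (LINT y|lebesgue_on (D \<inter> ball x r). \<bar>u y - g x\<bar>) / measure lebesgue (D \<inter> ball x r))
           \<longlongrightarrow> 0) (at_right 0))"

definition is_L2_trace ::
    "spacetime set \<Rightarrow> spacetime measure \<Rightarrow> (spacetime \<Rightarrow> real) \<Rightarrow> (spacetime \<Rightarrow> real) \<Rightarrow> bool" where
  "is_L2_trace D M u g \<longleftrightarrow> g \<in> L2 M \<and> is_trace D M u g"

lemma is_trace_continuous:
  assumes D: "D \<in> sets lebesgue" and u: "continuous_on (closure D) u"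
    and M: "space M \<subseteq> closure D"
  shows "is_trace D M u u"
proof -
  have "((\<lambda>r. (LINT y|lebesgue_on (D \<inter> ball x r). \<bar>u y - u x\<bar>) / measure lebesgue (D \<inter> ball x r))
          \<longlongrightarrow> 0) (at_right 0)" if "x \<in> closure D" for x
  proof (rule tendstoI)
    fix e :: real assume "e > 0"
    then have "e / 2 > 0" by (rule half_gt_zero)
    with u[unfolded continuous_on_iff, rule_format, OF that]
    obtain \<delta> where \<delta>: "\<delta> > 0" "\<And>y. y \<in> closure D \<Longrightarrow> dist y x < \<delta> \<Longrightarrow> dist (u y) (u x) < e / 2"
      by blast
    have small: "dist ((LINT y|lebesgue_on (D \<inter> ball x r). \<bar>u y - u x\<bar>)
        / measure lebesgue (D \<inter> ball x r)) 0 < e" if r: "r < \<delta>" for r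
    proof -
      define S where "S = D \<inter> ball x r"
      define J where "J = (LINT y|lebesgue_on S. \<bar>u y - u x\<bar>)"
      define m where "m = measure lebesgue S"
      have S: "S \<in> lmeasurable"
        unfolding S_def using D by (intro bounded_set_imp_lmeasurable) auto
      interpret finite_measure "lebesgue_on S"
        using S by (rule finite_measure_lebesgue_on)
      have "J \<le> (LINT y|lebesgue_on S. e / 2)"
        unfolding J_def
      proof (rule integral_mono_AE')
        show "integrable (lebesgue_on S) (\<lambda>_. e / 2)"
          by (rule integrable_const)
        show "AE y in lebesgue_on S. \<bar>u y - u x\<bar> \<le> e / 2"
        proof (rule AE_I2)
          fix y assume "y \<in> space (lebesgue_on S)"
          then have "y \<in> closure D" "dist y x < \<delta>"
            using r closure_subset by (auto simp: S_def dist_commute)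
          then show "\<bar>u y - u x\<bar> \<le> e / 2"
            using \<delta>(2) by (simp add: dist_real_def less_imp_le)
        qed
        show "AE y in lebesgue_on S. 0 \<le> e / 2"
          using \<open>e > 0\<close> by simp
      qed
      also have "\<dots> = e / 2 * m"
      proof -
        have "measure (lebesgue_on S) S = m"
          unfolding m_def by (rule measure_restrict_space) (use S in auto)
        then show ?thesis by (simp add: mult.commute)
      qed
      finally have le: "J \<le> e / 2 * m" .
      have "m \<ge> 0" "J \<ge> 0"
        by (simp_all add: m_def J_def)
      with le \<open>e > 0\<close> have "J / m \<le> e / 2" "0 \<le> J / m"
        by (cases "m = 0"; simp add: divide_le_eq)+
      with \<open>e > 0\<close> have "dist (J / m) 0 < e"
        unfolding dist_real_def by linarith
      then show ?thesis
        by (simp only: J_def m_def S_def)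
    qed
    show "\<forall>\<^sub>F r in at_right 0. dist ((LINT y|lebesgue_on (D \<inter> ball x r). \<bar>u y - u x\<bar>)
        / measure lebesgue (D \<inter> ball x r)) 0 < e"
      by (rule eventually_at_rightI[of 0 \<delta>]) (use small \<delta>(1) in auto)
  qed
  then show ?thesis
    unfolding is_trace_def by (intro AE_I2) (use M in blast)
qed

end

theory Submission
  imports Defs
begin

text \<open>
  The map \<open>G\<close> is affine, so it scales Lebesgue measure by \<open>\<bar>det B\<bar>\<close> and the surface measure of a lateral
  face by the ratio of the lengths of the two edges. An inscribed ball of radius \<open>\<rho>\<^sub>K\<close> inside \<open>K = H (ref_triangle)\<close>
  gives \<open>\<rho>\<^sub>K * \<bar>v\<bar> \<le> 2 * \<bar>B v\<bar>\<close>, hence lower bounds for \<open>\<bar>det B\<bar>\<close> and for the edges of \<open>K\<close>, and the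
  circumscribed circle gives \<open>\<bar>det B\<bar> \<le> 8 * h\<^sub>K\<^sup>2\<close>; shape regularity makes these comparable.
  Traces pull back under \<open>G\<close> because \<open>G\<close> distorts balls by bounded factors and, \<open>K\<close> being convex, the
  measure of \<open>D \<inter> ball x r\<close> drops at most by \<open>k ^ DIM\<close> when \<open>r\<close> is multiplied by \<open>k \<le> 1\<close>; the same
  property shows that traces are unique almost everywhere.
\<close>

section \<open>Change of variables for maps that scale Lebesgue measure\<close>

text \<open>Since \<open>c\<close> multiplies the image measure, it is the factor by which
  \<open>T\<close> enlarges sets. The law is stated for the completed measure because
  \<open>L2\<close> and \<open>is_trace\<close> are built on \<open>lebesgue_on\<close>, so
  substitution must cover all Lebesgue measurable functions.\<close>

locale lebesgue_scaling =
  fixes T :: "'a::euclidean_space \<Rightarrow> 'a" and c :: real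
  assumes inj_T: "inj T" and c_pos: "0 < c"
    and T_measurable: "T \<in> lebesgue \<rightarrow>\<^sub>M lebesgue"
    and lebesgue_eq: "lebesgue = density (distr lebesgue lebesgue T) (\<lambda>_. ennreal c)"
begin

lemma integrable_comp_iff:
  fixes f :: "'a \<Rightarrow> real"
  assumes f: "f \<in> borel_measurable lebesgue"
  shows "integrable lebesgue (\<lambda>x. f (T x)) \<longleftrightarrow> integrable lebesgue f"
proof -
  have "integrable lebesgue f \<longleftrightarrow> integrable (density (distr lebesgue lebesgue T) (\<lambda>_. ennreal c)) f"
    using lebesgue_eq by simp
  also have "\<dots> \<longleftrightarrow> integrable (distr lebesgue lebesgue T) (\<lambda>x. c *\<^sub>R f x)"
    by (rule integrable_density) (use f c_pos in auto)
  also have "\<dots> \<longleftrightarrow> integrable lebesgue (\<lambda>x. c *\<^sub>R f (T x))"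
    by (rule integrable_distr_eq) (use f T_measurable in auto)
  also have "\<dots> \<longleftrightarrow> integrable lebesgue (\<lambda>x. f (T x))"
    using c_pos by simp
  finally show ?thesis by simp
qed

lemma integral_comp:
  fixes f :: "'a \<Rightarrow> real"
  assumes f: "f \<in> borel_measurable lebesgue"
  shows "(LINT x|lebesgue. f x) = c * (LINT x|lebesgue. f (T x))"
proof -
  have "(LINT x|lebesgue. f x) = integral\<^sup>L (density (distr lebesgue lebesgue T) (\<lambda>_. ennreal c)) f"
    using lebesgue_eq by simp
  also have "\<dots> = integral\<^sup>L (distr lebesgue lebesgue T) (\<lambda>x. c *\<^sub>R f x)"
    by (rule integral_density) (use f c_pos in auto)
  also have "\<dots> = (LINT x|lebesgue. c *\<^sub>R f (T x))"
    by (rule integral_distr) (use f T_measurable in auto)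
  finally show ?thesis by simp
qed

text \<open>Injectivity of \<open>T\<close> is used here: extending by zero through indicators
  reduces every integral over an image set to one over the whole space.\<close>

lemma indicator_image: "indicator (T ` S) (T x) = (indicator S x :: real)"
  using inj_T by (auto simp: indicator_def dest: injD)

lemma borel_measurable_on_comp:
  fixes f :: "'a \<Rightarrow> real"
  assumes "S \<in> sets lebesgue" "T ` S \<in> sets lebesgue"
    and "f \<in> borel_measurable (lebesgue_on (T ` S))"
  shows "(\<lambda>x. f (T x)) \<in> borel_measurable (lebesgue_on S)"
proof -
  have "(\<lambda>x. indicator (T ` S) x *\<^sub>R f x) \<in> borel_measurable lebesgue"
    using assms by (simp add: borel_measurable_restrict_space_iff)
  from measurable_compose[OF T_measurable this]
  show ?thesis
    using assms by (simp add: borel_measurable_restrict_space_iff indicator_image)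
qed

lemma integrable_on_comp_iff:
  fixes f :: "'a \<Rightarrow> real"
  assumes "S \<in> sets lebesgue" "T ` S \<in> sets lebesgue"
    and "f \<in> borel_measurable (lebesgue_on (T ` S))"
  shows "integrable (lebesgue_on S) (\<lambda>x. f (T x)) \<longleftrightarrow> integrable (lebesgue_on (T ` S)) f"
proof -
  have "(\<lambda>x. indicator (T ` S) x *\<^sub>R f x) \<in> borel_measurable lebesgue"
    using assms by (simp add: borel_measurable_restrict_space_iff)
  from integrable_comp_iff[OF this] show ?thesis
    using assms by (simp add: integrable_restrict_space indicator_image)
qed

lemma integral_on_comp:
  fixes f :: "'a \<Rightarrow> real"
  assumes "S \<in> sets lebesgue" "T ` S \<in> sets lebesgue"
    and "f \<in> borel_measurable (lebesgue_on (T ` S))"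
  shows "(LINT x|lebesgue_on (T ` S). f x) = c * (LINT x|lebesgue_on S. f (T x))"
proof -
  have "(\<lambda>x. indicator (T ` S) x *\<^sub>R f x) \<in> borel_measurable lebesgue"
    using assms by (simp add: borel_measurable_restrict_space_iff)
  from integral_comp[OF this] show ?thesis
    using assms by (simp add: integral_restrict_space indicator_image)
qed

lemma measure_image:
  assumes "S \<in> sets lebesgue" "T ` S \<in> sets lebesgue"
  shows "measure lebesgue (T ` S) = c * measure lebesgue S"
  using integral_on_comp[OF assms, of "\<lambda>_. 1"] assms by (simp add: measure_restrict_space)

lemma L2_comp:
  assumes "S \<in> sets lebesgue" "T ` S \<in> sets lebesgue" and f: "f \<in> L2 (lebesgue_on (T ` S))"
  shows "f \<circ> T \<in> L2 (lebesgue_on S)"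
    and "(L2_norm (lebesgue_on (T ` S)) f)\<^sup>2 = c * (L2_norm (lebesgue_on S) (f \<circ> T))\<^sup>2"
proof -
  have m: "f \<in> borel_measurable (lebesgue_on (T ` S))"
    "(\<lambda>x. (f x)\<^sup>2) \<in> borel_measurable (lebesgue_on (T ` S))"
    using f by (auto simp: L2_def)
  show "f \<circ> T \<in> L2 (lebesgue_on S)"
    using f borel_measurable_on_comp[OF assms(1,2) m(1)] integrable_on_comp_iff[OF assms(1,2) m(2)]
    by (simp add: L2_def o_def)
  show "(L2_norm (lebesgue_on (T ` S)) f)\<^sup>2 = c * (L2_norm (lebesgue_on S) (f \<circ> T))\<^sup>2"
    using integral_on_comp[OF assms(1,2) m(2)] c_pos by (simp add: L2_norm_def o_def)
qed

end

section \<open>Lebesgue measure under the space-time map\<close>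

lemma continuous_on_matrix_vector_mult:
  fixes B :: "real^'n^'m"
  shows "continuous_on S f \<Longrightarrow> continuous_on S (\<lambda>x. B *v f x)"
  by (rule bounded_linear.continuous_on[OF matrix_vector_mul_bounded_linear])

text \<open>A Borel scaling law extends to the completion, since null sets are preserved.\<close>

lemma lebesgue_scaling_if_lborel:
  fixes T :: "'a::euclidean_space \<Rightarrow> 'a"
  assumes inj: "inj T" and c: "0 < c" and T[measurable]: "T \<in> borel \<rightarrow>\<^sub>M borel"
    and eq: "lborel = density (distr lborel borel T) (\<lambda>_. ennreal c)"
  shows "lebesgue_scaling T c"
proof
  \<comment> \<open>\<open>lborel\<close> is \<open>c\<close> times the image measure with
    \<open>c\<close> positive, so both have the same Borel null sets. This gives measurability
    between the completions and lets completion and image measure be exchanged.\<close>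
  have "emeasure lborel A = 0 \<longleftrightarrow> emeasure (distr lebesgue lborel T) A = 0"
    if A: "A \<in> sets borel" for A
  proof -
    have "emeasure lborel A = emeasure (density (distr lborel borel T) (\<lambda>_. ennreal c)) A"
      using eq by simp
    also have "\<dots> = ennreal c * emeasure (distr lebesgue lborel T) A"
      using A by (simp add: distr_completion emeasure_density nn_integral_cmult cong: distr_cong)
    finally show ?thesis using c by simp
  qed
  then have null: "null_sets lborel = null_sets (distr lebesgue lborel T)"
    by (auto simp: null_sets_def)
  show "T \<in> lebesgue \<rightarrow>\<^sub>M lebesgue"
    by (simp add: completion.measurable_completion2 null measurable_completion)
  have "lebesgue = completion (density (distr lborel borel T) (\<lambda>_. ennreal c))"
    using eq by simp
  also have "\<dots> = density (completion (distr lebesgue lborel T)) (\<lambda>_. ennreal c)"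
    using c by (auto intro!: completion_density_eq simp: distr_completion cong: distr_cong)
  also have "\<dots> = density (distr lebesgue lebesgue T) (\<lambda>_. ennreal c)"
    by (subst completion.completion_distr_eq) (auto simp: null measurable_completion)
  finally show "lebesgue = density (distr lebesgue lebesgue T) (\<lambda>_. ennreal c)" .
qed (use inj c in auto)

text \<open>The preimage is the translated box mapped by the inverse of \<open>B\<close>, hence of
  finite measure. Mapping it forward by \<open>B\<close> and translating gives back the box, so the
  determinant rule for linear images applies.\<close>

lemma emeasure_lborel_vimage_affine:
  fixes B :: "real^'n::{finite,wellorder}^'n::{finite,wellorder}"
  assumes B: "invertible B"
  shows "ennreal \<bar>det B\<bar> * emeasure lborel ((\<lambda>x. B *v x + d) -` box l u) = emeasure lborel (box l u)"
proof -
  let ?S = "(\<lambda>x. B *v x + d) -` box l u"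
  obtain B' where B': "B ** B' = mat 1" "B' ** B = mat 1"
    using B by (auto simp: invertible_def)
  have inv[simp]: "B *v (B' *v x) = x" "B' *v (B *v x) = x" for x
    by (simp_all add: matrix_vector_mul_assoc B')
  have S: "?S = (*v) B' ` ((\<lambda>x. x - d) ` box l u)"
  proof (intro set_eqI iffI)
    fix x assume "x \<in> ?S"
    moreover have "x = B' *v (B *v x + d - d)" by simp
    ultimately show "x \<in> (*v) B' ` ((\<lambda>x. x - d) ` box l u)" by blast
  qed auto
  have "(\<lambda>x. x - d) ` box l u \<in> lmeasurable"
    by (rule measurable_translation_subtract) simp
  then have Sm: "?S \<in> lmeasurable"
    unfolding S by (rule measurable_linear_image[OF matrix_vector_mul_linear])
  have "(\<lambda>x. d + x) ` (*v) B ` ?S = box l u"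
  proof -
    have "x = d + B *v (B' *v (x - d))" "B' *v (x - d) \<in> ?S" if "x \<in> box l u" for x
      using that by auto
    then show ?thesis by (fastforce simp: add.commute)
  qed
  then have "measure lebesgue (box l u) = measure lebesgue ((\<lambda>x. d + x) ` (*v) B ` ?S)"
    by simp
  also have "\<dots> = \<bar>det B\<bar> * measure lebesgue ?S"
    using Sm by (simp add: measure_translation measure_linear_image)
  finally have eq: "ennreal (measure lebesgue (box l u)) = ennreal \<bar>det B\<bar> * ennreal (measure lebesgue ?S)"
    by (simp add: ennreal_mult)
  have S_borel: "?S \<in> sets borel"
    by (rule measurable_sets_borel[where M=borel]) (auto intro!: borel_measurable_continuous_onI continuous_on_add
        continuous_on_matrix_vector_mult continuous_on_id)
  have "emeasure lborel A = ennreal (measure lebesgue A)" if "A \<in> sets borel" "A \<in> lmeasurable"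
    for A :: "(real^'n::{finite,wellorder}) set"
    using that emeasure_eq_measure2[of A lebesgue] by simp
  then show ?thesis
    using eq S_borel Sm by simp
qed

lemma borel_measurable_G_map: "G_map B d \<in> borel_measurable borel"
  unfolding G_map_def
  by (intro borel_measurable_continuous_onI continuous_on_Pair continuous_on_add
      continuous_on_matrix_vector_mult continuous_on_fst continuous_on_snd continuous_on_id
      continuous_on_const)

text \<open>Boxes determine \<open>lborel\<close>. The preimage of a box is again a product with
  unchanged time factor, so the product measure reduces the claim to the planar rule for
  \<open>B\<close>.\<close>

lemma lborel_G_map:
  assumes B: "invertible B"
  shows "lborel = density (distr lborel borel (G_map B d)) (\<lambda>_. ennreal \<bar>det B\<bar>)"
proof (rule lborel_eqI)
  fix l u :: spacetime assume le: "\<And>b. b \<in> Basis \<Longrightarrow> l \<bullet> b \<le> u \<bullet> b"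
  obtain l1 l2 u1 u2 where lu: "l = (l1, l2)" "u = (u1, u2)" by fastforce
  let ?S = "(\<lambda>x. B *v x + d) -` box l2 u2"
  have S: "?S \<in> sets borel"
    by (rule measurable_sets_borel[where M=borel]) (auto intro!: borel_measurable_continuous_onI continuous_on_add
        continuous_on_matrix_vector_mult continuous_on_id)
  have box: "box l u = box l1 u1 \<times> box l2 u2"
    by (auto simp: lu box_def Basis_prod_def ball_Un)
  have vim: "G_map B d -` box l u = box l1 u1 \<times> ?S"
    unfolding box by (auto simp: G_map_def)
  have "emeasure (density (distr lborel borel (G_map B d)) (\<lambda>_. ennreal \<bar>det B\<bar>)) (box l u)
      = ennreal \<bar>det B\<bar> * emeasure (lborel \<Otimes>\<^sub>M lborel) (box l1 u1 \<times> ?S)"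
    using borel_measurable_G_map[of B d] by (simp add: emeasure_density nn_integral_cmult emeasure_distr vim lborel_prod)
  also have "\<dots> = emeasure lborel (box l1 u1) * (ennreal \<bar>det B\<bar> * emeasure lborel ?S)"
    using S by (subst lborel.emeasure_pair_measure_Times) (auto simp: mult_ac)
  also have "\<dots> = emeasure (lborel \<Otimes>\<^sub>M lborel) (box l1 u1 \<times> box l2 u2)"
    using B by (subst lborel.emeasure_pair_measure_Times) (auto simp: emeasure_lborel_vimage_affine)
  also have "\<dots> = (\<Prod>b\<in>Basis. (u - l) \<bullet> b)"
    unfolding lborel_prod box[symmetric] by (rule emeasure_lborel_box[OF le])
  finally show "emeasure (density (distr lborel borel (G_map B d)) (\<lambda>_. ennreal \<bar>det B\<bar>)) (box l u)
      = (\<Prod>b\<in>Basis. (u - l) \<bullet> b)" .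
qed simp

lemma inj_G_map:
  assumes "invertible B" shows "inj (G_map B d)"
  using inj_matrix_vector_mult[OF assms] by (auto simp: inj_on_def G_map_def)

lemma lebesgue_scaling_G_map:
  assumes B: "invertible B"
  shows "lebesgue_scaling (G_map B d) \<bar>det B\<bar>"
  by (rule lebesgue_scaling_if_lborel)
    (use B in \<open>auto simp: invertible_det_nz inj_G_map lborel_G_map borel_measurable_G_map\<close>)

section \<open>Mean deviations on small balls in convex sets\<close>

lemma measurable_convex_ball:
  fixes D :: "'a::euclidean_space set"
  shows "convex D \<Longrightarrow> D \<inter> ball x r \<in> lmeasurable"
  by (intro measurable_convex convex_Int convex_ball bounded_Int) auto

text \<open>The homothety with centre \<open>x\<close> and ratio \<open>k\<close> keeps a convex
  \<open>D\<close> inside itself, maps the ball of radius \<open>r\<close> into that of radius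
  \<open>k * r\<close>, and scales measure by the power of \<open>k\<close>.\<close>

lemma measure_convex_ball_scale:
  fixes D :: "'a::euclidean_space set"
  assumes D: "convex D" "x \<in> D" and k: "0 < k" "k \<le> 1"
  shows "k ^ DIM('a) * measure lebesgue (D \<inter> ball x r) \<le> measure lebesgue (D \<inter> ball x (k * r))"
proof -
  let ?f = "\<lambda>y. k *\<^sub>R y + (1 - k) *\<^sub>R x"
  have "?f y \<in> D \<inter> ball x (k * r)" if y: "y \<in> D \<inter> ball x r" for y
  proof -
    have "?f y \<in> D"
      using y D k by (auto intro!: convexD)
    moreover have "x - ?f y = k *\<^sub>R (x - y)"
      by (simp add: algebra_simps)
    then have "dist x (?f y) = k * dist x y"
      using k by (simp add: dist_norm)
    ultimately show ?thesis
      using y k by simp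
  qed
  then have sub: "?f ` (D \<inter> ball x r) \<subseteq> D \<inter> ball x (k * r)"
    by blast
  have "?f ` (D \<inter> ball x r) = (\<lambda>y. (1 - k) *\<^sub>R x + y) ` (*\<^sub>R) k ` (D \<inter> ball x r)"
    by (auto simp: image_image add.commute)
  also have "convex \<dots>"
    using D by (intro convex_translation convex_scaling convex_Int convex_ball)
  finally have "?f ` (D \<inter> ball x r) \<in> lmeasurable"
    by (rule measurable_convex) (use sub in \<open>blast intro: bounded_subset[OF bounded_ball]\<close>)
  then have "measure lebesgue (?f ` (D \<inter> ball x r)) \<le> measure lebesgue (D \<inter> ball x (k * r))"
    using sub measurable_convex_ball[OF D(1)] by (intro measure_mono_fmeasurable) auto
  then show ?thesis
    using k by (simp add: measure_lebesgue_affine)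
qed

text \<open>Shrink from a radius \<open>R\<close> at which the ball covers all of \<open>D\<close>;
  taking \<open>R\<close> at least \<open>r\<close> keeps the ratio at most 1.\<close>

lemma measure_convex_ball_pos:
  fixes D :: "'a::euclidean_space set"
  assumes D: "convex D" "bounded D" "0 < measure lebesgue D" and x: "x \<in> D" and r: "0 < r"
  shows "0 < measure lebesgue (D \<inter> ball x r)"
proof -
  obtain R0 where "D \<subseteq> ball x R0"
    using D(2) bounded_subset_ballD by blast
  define R where "R = max R0 r"
  have R: "D \<inter> ball x R = D" "0 < R" "r \<le> R"
    using \<open>D \<subseteq> ball x R0\<close> r by (auto simp: R_def)
  then show ?thesis
    using measure_convex_ball_scale[OF D(1) x, of "r / R" R] D(3) r
    by (simp add: zero_less_mult_iff order_less_le_trans[rotated])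
qed

text \<open>The quotient whose limit \<open>is_trace\<close> requires, with the radius as last
  argument so that limits concern a partial application.\<close>

definition mean_deviation :: "'a::euclidean_space set \<Rightarrow> ('a \<Rightarrow> real) \<Rightarrow> real \<Rightarrow> 'a \<Rightarrow> real \<Rightarrow> real" where
  "mean_deviation D u a x r =
     (LINT y|lebesgue_on (D \<inter> ball x r). \<bar>u y - a\<bar>) / measure lebesgue (D \<inter> ball x r)"

lemma mean_deviation_nonneg: "0 \<le> mean_deviation D u a x r"
  by (simp add: mean_deviation_def)

lemma integrable_deviation:
  fixes D :: "'a::euclidean_space set" and u :: "'a \<Rightarrow> real"
  assumes u: "integrable (lebesgue_on D) u" and S: "S \<in> lmeasurable" "S \<subseteq> D" "D \<in> lmeasurable"
  shows "integrable (lebesgue_on S) (\<lambda>y. \<bar>u y - a\<bar>)"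
proof -
  have "integrable lebesgue (\<lambda>y. indicator D y *\<^sub>R u y)"
    using u S by (simp add: integrable_restrict_space fmeasurableD)
  then have "integrable lebesgue (\<lambda>y. indicator S y *\<^sub>R indicator D y *\<^sub>R u y)"
    using S by (intro integrable_mult_indicator[of S lebesgue "\<lambda>y. indicator D y *\<^sub>R u y"]) auto
  also have "(\<lambda>y. indicator S y *\<^sub>R indicator D y *\<^sub>R u y) = (\<lambda>y. indicator S y *\<^sub>R u y)"
    using S by (auto simp: indicator_def fun_eq_iff)
  finally have "integrable (lebesgue_on S) u"
    using S by (simp add: integrable_restrict_space fmeasurableD)
  moreover have "integrable (lebesgue_on S) (\<lambda>_. a)"
    using S finite_measure_lebesgue_on by (intro finite_measure.integrable_const) auto
  ultimately show ?thesis by (intro integrable_abs Bochner_Integration.integrable_diff)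
qed

lemma integral_lebesgue_on_mono_set:
  fixes f :: "'a::euclidean_space \<Rightarrow> real"
  assumes "integrable (lebesgue_on A) f" "integrable (lebesgue_on B) f"
    and "A \<in> sets lebesgue" "B \<in> sets lebesgue" "A \<subseteq> B" "\<And>x. 0 \<le> f x"
  shows "(LINT x|lebesgue_on A. f x) \<le> (LINT x|lebesgue_on B. f x)"
  using assms
  by (auto simp: integrable_restrict_space integral_restrict_space indicator_def intro!: integral_mono)

text \<open>Average the triangle inequality for \<open>a\<close>, \<open>u y\<close> and
  \<open>b\<close> over the part of \<open>D\<close> in a small ball. Positive measure matters:
  division by zero would make the quotient 0 for every value.\<close>

lemma mean_deviation_limit_unique:
  fixes D :: "'a::euclidean_space set"
  assumes D: "convex D" "bounded D" "0 < measure lebesgue D" and x: "x \<in> D"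
    and u: "integrable (lebesgue_on D) u"
    and a: "(mean_deviation D u a x \<longlongrightarrow> 0) (at_right 0)"
    and b: "(mean_deviation D u b x \<longlongrightarrow> 0) (at_right 0)"
  shows "a = b"
proof -
  have "\<bar>a - b\<bar> \<le> mean_deviation D u a x r + mean_deviation D u b x r" if r: "0 < r" for r
  proof -
    let ?S = "D \<inter> ball x r"
    have S: "?S \<in> lmeasurable" "D \<in> lmeasurable"
      using D by (simp_all add: measurable_convex_ball measurable_convex)
    have pos: "0 < measure lebesgue ?S"
      using measure_convex_ball_pos D x r by blast
    have int: "integrable (lebesgue_on ?S) (\<lambda>y. \<bar>u y - t\<bar>)" for t
      using integrable_deviation[OF u S(1) _ S(2)] by simp
    have "\<bar>a - b\<bar> * measure lebesgue ?S = (LINT y|lebesgue_on ?S. \<bar>a - b\<bar>)"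
      using S by (simp add: measure_restrict_space)
    also have "\<dots> \<le> (LINT y|lebesgue_on ?S. \<bar>u y - a\<bar> + \<bar>u y - b\<bar>)"
      using S finite_measure_lebesgue_on int
      by (intro integral_mono finite_measure.integrable_const Bochner_Integration.integrable_add) auto
    also have "\<dots> = (LINT y|lebesgue_on ?S. \<bar>u y - a\<bar>) + (LINT y|lebesgue_on ?S. \<bar>u y - b\<bar>)"
      using int by simp
    finally show ?thesis
      using pos by (simp add: mean_deviation_def field_simps)
  qed
  then have ev: "\<forall>\<^sub>F r in at_right 0. \<bar>a - b\<bar> \<le> mean_deviation D u a x r + mean_deviation D u b x r"
    by (auto simp: eventually_at_filter)
  have "((\<lambda>r. mean_deviation D u a x r + mean_deviation D u b x r) \<longlongrightarrow> 0) (at_right 0)"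
    using tendsto_add[OF a b] by simp
  from tendsto_lowerbound[OF this ev] show ?thesis by simp
qed

lemma (in lebesgue_scaling) mean_deviation_comp_tendsto:
  assumes D: "convex D" "bounded (T ` D)" "0 < measure lebesgue (T ` D)"
    and u: "integrable (lebesgue_on (T ` D)) u"
    and T_convex: "\<And>S. convex S \<Longrightarrow> convex (T ` S)"
    and m: "0 < m" "\<And>y z. m * dist y z \<le> dist (T y) (T z)"
    and M: "\<And>y z. dist (T y) (T z) \<le> M * dist y z"
    and x: "x \<in> D"
    and lim: "(mean_deviation (T ` D) u a (T x) \<longlongrightarrow> 0) (at_right 0)"
  shows "(mean_deviation D (u \<circ> T) a x \<longlongrightarrow> 0) (at_right 0)"
proof -
  note TD = T_convex[OF D(1)] D(2,3)
  \<comment> \<open>\<open>T\<close> maps \<open>D \<inter> ball x r\<close> between the parts of \<open>T ` D\<close> in balls around \<open>T x\<close> of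
    radius \<open>m * r\<close> and \<open>(M + m) * r\<close>, whose measures are comparable by convexity.\<close>
  define q where "q = (m / (M + m)) ^ DIM('a)"
  \<comment> \<open>Comparing both Lipschitz bounds on a unit vector and 0 gives
    \<open>m \<le> M\<close>, hence positivity of \<open>M\<close>.\<close>
  obtain b :: 'a where "b \<in> Basis" using nonempty_Basis by blast
  then have "m \<le> M"
    using order_trans[OF m(2)[of b 0] M[of b 0]] by simp
  with m have M_pos: "0 < M" by simp
  have q: "0 < q" using m M_pos by (simp add: q_def)
  have bound: "mean_deviation D (u \<circ> T) a x r \<le> mean_deviation (T ` D) u a (T x) ((M + m) * r) / q"
    if r: "0 < r" for r
  proof -
    let ?S = "D \<inter> ball x r" and ?L = "T ` D \<inter> ball (T x) ((M + m) * r)"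
    have S: "?S \<in> sets lebesgue" "convex ?S"
      using D(1) measurable_convex_ball by (auto intro: convex_Int)
    have sub: "T ` ?S \<subseteq> ?L"
    proof
      fix z assume "z \<in> T ` ?S"
      then obtain y where y: "y \<in> D" "z = T y" "dist x y < r" by auto
      then have "M * dist x y < M * r" using M_pos by simp
      moreover have "0 < m * r" using m r by simp
      ultimately have "dist (T x) (T y) < (M + m) * r"
        using M[of x y] by (simp add: distrib_right)
      then show "z \<in> ?L" using y by simp
    qed
    have TS: "T ` ?S \<in> lmeasurable"
      by (intro measurable_convex T_convex S) (use sub in \<open>blast intro: bounded_subset[OF bounded_ball]\<close>)
    have L: "?L \<in> lmeasurable" "T ` D \<in> lmeasurable"
      using TD by (simp_all add: measurable_convex measurable_convex_ball)
    have sup: "T ` D \<inter> ball (T x) (m * r) \<subseteq> T ` ?S"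
    proof
      fix z assume "z \<in> T ` D \<inter> ball (T x) (m * r)"
      then obtain y where y: "y \<in> D" "z = T y" "dist (T x) (T y) < m * r" by auto
      then have "m * dist x y < m * r" using m(2)[of x y] by simp
      then show "z \<in> T ` ?S" using m(1) y by simp
    qed
    have intL: "integrable (lebesgue_on ?L) (\<lambda>y. \<bar>u y - a\<bar>)" 
      by (rule integrable_deviation[OF u L(1) _ L(2)]) simp
    have intS: "integrable (lebesgue_on (T ` ?S)) (\<lambda>y. \<bar>u y - a\<bar>)" 
      by (rule integrable_deviation[OF u TS _ L(2)]) auto
    have num: "(LINT y|lebesgue_on (T ` ?S). \<bar>u y - a\<bar>) \<le> (LINT y|lebesgue_on ?L. \<bar>u y - a\<bar>)"
      using intS intL sub L TS by (intro integral_lebesgue_on_mono_set) (auto simp: fmeasurableD)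
    have "T ` D \<inter> ball (T x) (m * r) = T ` D \<inter> ball (T x) (m / (M + m) * ((M + m) * r))"
      using m M_pos by simp
    then have "q * measure lebesgue ?L \<le> measure lebesgue (T ` D \<inter> ball (T x) (m * r))"
      using measure_convex_ball_scale[OF TD(1), of "T x" "m / (M + m)" "(M + m) * r"] x m M_pos
      by (simp add: q_def)
    also have "\<dots> \<le> measure lebesgue (T ` ?S)"
      using sup TS measurable_convex_ball[OF TD(1)] by (intro measure_mono_fmeasurable) auto
    finally have den: "q * measure lebesgue ?L \<le> measure lebesgue (T ` ?S)" .
    have Lpos: "0 < measure lebesgue ?L"
      using TD x m M_pos r by (intro measure_convex_ball_pos) auto
    \<comment> \<open>The factor \<open>c\<close> appears in numerator and denominator and
      cancels.\<close>
    have "mean_deviation D (u \<circ> T) a x r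
        = (LINT y|lebesgue_on (T ` ?S). \<bar>u y - a\<bar>) / measure lebesgue (T ` ?S)"
      using c_pos intS S TS
      by (simp add: mean_deviation_def integral_on_comp measure_image fmeasurableD o_def)
    also have "\<dots> \<le> (LINT y|lebesgue_on ?L. \<bar>u y - a\<bar>) / (q * measure lebesgue ?L)"
      using num den Lpos q by (intro frac_le) auto
    finally show ?thesis by (simp add: mean_deviation_def mult.commute)
  qed
  have "filterlim (\<lambda>r. (M + m) * r) (at_right 0) (at_right 0)"
    using m M_pos by (intro filterlim_times_pos[where p = 0] filterlim_ident) auto
  from filterlim_compose[OF lim this]
  have upper: "((\<lambda>r. mean_deviation (T ` D) u a (T x) ((M + m) * r) / q) \<longlongrightarrow> 0) (at_right 0)"
    using tendsto_divide_zero by blast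
  show ?thesis
  proof (rule tendsto_sandwich[OF _ _ tendsto_const upper])
    show "\<forall>\<^sub>F r in at_right 0. 0 \<le> mean_deviation D (u \<circ> T) a x r"
      by (simp add: mean_deviation_nonneg)
    show "\<forall>\<^sub>F r in at_right 0. mean_deviation D (u \<circ> T) a x r
        \<le> mean_deviation (T ` D) u a (T x) ((M + m) * r) / q"
      using bound by (auto simp: eventually_at_filter)
  qed
qed

section \<open>Surface measure on lateral faces\<close>

definition face_param :: "real^2 \<Rightarrow> real^2 \<Rightarrow> real \<times> real \<Rightarrow> spacetime" where
  "face_param p q = (\<lambda>(t, s). (t, p + s *\<^sub>R (q - p)))"

lemma inj_face_param: "p \<noteq> q \<Longrightarrow> inj (face_param p q)"
  by (auto simp: inj_on_def face_param_def)

text \<open>An affine map preserves the position \<open>s\<close> along a segment. Hence a face and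
  its image are parametrized by the same rectangle, and their surface measures differ only through
  the factor \<open>dist\<close>.\<close>

lemma G_map_face_param:
  "G_map B d (face_param p q y) = face_param (H_map B d p) (H_map B d q) y"
  by (cases y) (simp add: G_map_def face_param_def H_map_def matrix_vector_right_distrib
      matrix_vector_mult_diff_distrib matrix_vector_mult_scaleR)

lemma face_measure_eq:
  "face_measure p q t0 t1 =
     density (embed_measure (lebesgue_on ({t0<..<t1} \<times> {0..1})) (face_param p q))
       (\<lambda>_. ennreal (dist p q))"
  by (simp add: face_measure_def face_param_def)

context
  fixes p q :: "real^2" and t0 t1 :: real
  assumes pq: "p \<noteq> q"
begin

lemma AE_face_measure_iff:
  "(AE x in face_measure p q t0 t1. P x) \<longleftrightarrow>
     (AE y in lebesgue_on ({t0<..<t1} \<times> {0..1}). P (face_param p q y))"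
proof -
  have "(AE x in face_measure p q t0 t1. P x) \<longleftrightarrow>
      (AE x in embed_measure (lebesgue_on ({t0<..<t1} \<times> {0..1})) (face_param p q). P x)"
    \<comment> \<open>The density is a positive constant because \<open>p \<noteq> q\<close>, so
      null sets are unchanged.\<close>
    unfolding face_measure_eq using pq by (subst AE_density) simp_all
  then show ?thesis
    by (simp only: AE_embed_measure[OF inj_face_param[OF pq]])
qed

lemma borel_measurable_face_measure_iff:
  fixes g :: "spacetime \<Rightarrow> real"
  shows "g \<in> borel_measurable (face_measure p q t0 t1) \<longleftrightarrow>
     (\<lambda>y. g (face_param p q y)) \<in> borel_measurable (lebesgue_on ({t0<..<t1} \<times> {0..1}))"
  using measurable_compose[OF measurable_embed_measure2[OF inj_face_param[OF pq]]]
  by (auto simp: face_measure_eq intro: measurable_embed_measure1)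

lemma integral_face_measure:
  fixes g :: "spacetime \<Rightarrow> real"
  assumes g: "g \<in> borel_measurable (face_measure p q t0 t1)"
  shows "integrable (face_measure p q t0 t1) g \<longleftrightarrow>
      integrable (lebesgue_on ({t0<..<t1} \<times> {0..1})) (\<lambda>y. g (face_param p q y))"
    and "(LINT x|face_measure p q t0 t1. g x) =
      dist p q * (LINT y|lebesgue_on ({t0<..<t1} \<times> {0..1}). g (face_param p q y))"
proof -
  let ?M = "lebesgue_on ({t0<..<t1} \<times> {0..1}) :: (real \<times> real) measure"
  let ?N = "embed_measure ?M (face_param p q)"
  have inj: "inj (face_param p q)" using pq by (rule inj_face_param)
  have g': "g \<in> borel_measurable ?N" using g by (simp add: face_measure_eq)
  have N: "integrable ?N f \<longleftrightarrow> integrable ?M (\<lambda>y. f (face_param p q y))"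
    "integral\<^sup>L ?N f = (LINT y|?M. f (face_param p q y))"
    if f: "f \<in> borel_measurable ?N" for f :: "spacetime \<Rightarrow> real"
  proof -
    note eq = embed_measure_eq_distr[OF inj, of ?M]
    note meas = measurable_embed_measure2[OF inj, of ?M]
    show "integrable ?N f \<longleftrightarrow> integrable ?M (\<lambda>y. f (face_param p q y))"
      by (subst eq) (rule integrable_distr_eq[OF meas f])
    show "integral\<^sup>L ?N f = (LINT y|?M. f (face_param p q y))"
      by (subst eq) (rule integral_distr[OF meas f])
  qed
  show "integrable (face_measure p q t0 t1) g \<longleftrightarrow> integrable ?M (\<lambda>y. g (face_param p q y))"
    using g' pq by (simp add: face_measure_eq integrable_density N)
  show "(LINT x|face_measure p q t0 t1. g x) = dist p q * (LINT y|?M. g (face_param p q y))"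
    using g' by (simp add: face_measure_eq integral_density N)
qed

end

text \<open>Both squared norms are the respective edge length times the same integral over the
  parameter rectangle; cross multiplication avoids a quotient of lengths.\<close>

lemma face_comp_G_map:
  assumes pq: "p \<noteq> q" "H_map B d p \<noteq> H_map B d q"
    and g: "g \<in> L2 (face_measure (H_map B d p) (H_map B d q) t0 t1)"
  shows "g \<circ> G_map B d \<in> L2 (face_measure p q t0 t1)"
    and "dist (H_map B d p) (H_map B d q) * (L2_norm (face_measure p q t0 t1) (g \<circ> G_map B d))\<^sup>2
       = dist p q * (L2_norm (face_measure (H_map B d p) (H_map B d q) t0 t1) g)\<^sup>2"
proof -
  let ?F = "face_measure (H_map B d p) (H_map B d q) t0 t1" and ?F' = "face_measure p q t0 t1"
  have m: "g \<in> borel_measurable ?F" "(\<lambda>x. (g x)\<^sup>2) \<in> borel_measurable ?F"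
    using g by (auto simp: L2_def)
  then have m': "g \<circ> G_map B d \<in> borel_measurable ?F'" "(\<lambda>x. ((g \<circ> G_map B d) x)\<^sup>2) \<in> borel_measurable ?F'"
    using pq by (simp_all add: borel_measurable_face_measure_iff G_map_face_param)
  show "g \<circ> G_map B d \<in> L2 ?F'"
    using g m m' pq by (simp add: L2_def integral_face_measure(1) G_map_face_param)
  show "dist (H_map B d p) (H_map B d q) * (L2_norm ?F' (g \<circ> G_map B d))\<^sup>2
       = dist p q * (L2_norm ?F g)\<^sup>2"
    using integral_face_measure(2)[OF pq(1) m'(2)] integral_face_measure(2)[OF pq(2) m(2)]
    by (simp add: L2_norm_def G_map_face_param)
qed

lemma AE_face_comp_G_map:
  assumes "p \<noteq> q" "H_map B d p \<noteq> H_map B d q"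
    and "AE x in face_measure (H_map B d p) (H_map B d q) t0 t1. P x"
  shows "AE x in face_measure p q t0 t1. P (G_map B d x)"
  using assms by (simp add: AE_face_measure_iff G_map_face_param)

lemma ref_triangle_bounds:

  \<comment> \<open>Geometry of the reference triangle and bounds for the matrix\<close>
  assumes "x \<in> ref_triangle" shows "0 \<le> x $ i" "x $ i \<le> 1"
proof -
  have "ref_vertices \<subseteq> cbox 0 1"
    by (auto simp: ref_vertices_def mem_box_cart forall_2)
  then have "ref_triangle \<subseteq> cbox 0 1"
    unfolding ref_triangle_def by (intro hull_minimal convex_box)
  then show "0 \<le> x $ i" "x $ i \<le> 1"
    using assms by (auto simp: mem_box_cart)
qed

text \<open>Two points of the unit square differ by at most 1 in each coordinate, so the l1 norm
  gives 2; a sharper diameter would only change constants.\<close>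

lemma dist_ref_triangle_le: "x \<in> ref_triangle \<Longrightarrow> y \<in> ref_triangle \<Longrightarrow> dist x y \<le> 2"
  using ref_triangle_bounds[of x 1] ref_triangle_bounds[of x 2]
    ref_triangle_bounds[of y 1] ref_triangle_bounds[of y 2]
    norm_le_l1_cart[of "x - y"]
  by (simp add: dist_norm sum_2)

lemma abs_det_2_le:
  fixes A :: "real^2^2"
  assumes "\<And>i j. \<bar>A $ i $ j\<bar> \<le> m"
  shows "\<bar>det A\<bar> \<le> 2 * m\<^sup>2"
proof -
  have "\<bar>A $ i $ j * A $ k $ l\<bar> \<le> m * m" for i j k l
    unfolding abs_mult using assms order_trans[OF abs_ge_zero assms] by (intro mult_mono) auto
  from this[of 1 1 2 2] this[of 1 2 2 1] show ?thesis
    by (simp add: det_2 power2_eq_square abs_le_iff)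
qed

text \<open>Differences of points of \<open>cball z r\<close> are images of differences of points of the reference
  triangle, which are bounded by the diameter of the latter.\<close>

lemma ref_triangle_image_contains_ball:
  assumes r: "0 < r" and sub: "cball z r \<subseteq> H_map B d ` ref_triangle"
  shows "invertible B" and "r * norm v \<le> 2 * norm (B *v v)" and "r\<^sup>2 \<le> 8 * \<bar>det B\<bar>"
proof -
  have pre: "\<exists>v. B *v v = w \<and> norm v \<le> 2" if w: "norm w \<le> r" for w
  proof -
    have "z + w \<in> cball z r" "z \<in> cball z r" using w r by (simp_all add: dist_norm)
    then obtain a b where "a \<in> ref_triangle" "b \<in> ref_triangle" "z + w = B *v a + d" "z = B *v b + d"
      using sub unfolding H_map_def by (metis (no_types, lifting) imageE subsetD)
    then show ?thesis
      using dist_ref_triangle_le[of a b]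
      by (intro exI[of _ "a - b"]) (simp add: matrix_vector_mult_diff_distrib dist_norm algebra_simps)
  qed
  \<comment> \<open>\<open>pre\<close> covers short vectors only; rescaling \<open>w\<close> to norm
    \<open>r\<close> extends it to all \<open>w\<close> by homogeneity.\<close>
  have scaled: "\<exists>v. B *v v = w \<and> r * norm v \<le> 2 * norm w" for w
  proof (cases "w = 0")
    case True then show ?thesis by (intro exI[of _ 0]) simp
  next
    case False
    let ?k = "r / norm w"
    have k: "0 < ?k" using r False by simp
    obtain v where v: "B *v v = ?k *\<^sub>R w" "norm v \<le> 2"
      using pre[of "?k *\<^sub>R w"] r False by auto
    have "B *v (inverse ?k *\<^sub>R v) = w"
      using v(1) r False by (simp add: matrix_vector_mult_scaleR)
    moreover have "r * norm (inverse ?k *\<^sub>R v) = norm w * norm v"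
      using r False by simp
    ultimately show ?thesis
      using mult_left_mono[OF v(2) norm_ge_zero[of w]]
      by (intro exI[of _ "inverse ?k *\<^sub>R v"]) (simp only: mult.commute)
  qed
  then have "surj ((*v) B)" by (metis surj_def)
  then obtain A where A: "B ** A = mat 1" by (auto simp flip: matrix_right_invertible_surjective)
  then have A': "A ** B = mat 1" using matrix_left_right_inverse by blast
  show "invertible B" using A A' by (auto simp: invertible_def)
  have bound: "r * norm v \<le> 2 * norm (B *v v)" for v
  proof -
    obtain v' where v': "B *v v' = B *v v" "r * norm v' \<le> 2 * norm (B *v v)"
      using scaled by blast
    moreover have "A *v (B *v x) = x" for x
      by (simp add: matrix_vector_mul_assoc A')
    ultimately have "v' = v" by metis
    with v' show ?thesis by simp
  qed
  then show "r * norm v \<le> 2 * norm (B *v v)" .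
  \<comment> \<open>The determinant of \<open>B\<close> is bounded below through its inverse:
    entries of \<open>A\<close> are at most \<open>2 / r\<close>, so its determinant is at most 8
    over the square of \<open>r\<close>, and the two determinants multiply to 1.\<close>
  have "\<bar>A $ i $ j\<bar> \<le> 2 / r" for i j
  proof -
    have "\<bar>A $ i $ j\<bar> \<le> norm (A *v axis j 1)"
      using component_le_norm_cart[of "A *v axis j 1" i] by (simp add: matrix_vector_mul_component inner_axis)
    moreover have "r * norm (A *v axis j 1) \<le> 2"
      using bound[of "A *v axis j 1"] by (simp add: matrix_vector_mul_assoc A)
    ultimately show ?thesis
      using r by (simp add: pos_le_divide_eq mult.commute) (smt (verit) mult_left_mono)
  qed
  then have "\<bar>det A\<bar> \<le> 8 / r\<^sup>2"
    using abs_det_2_le[of A "2 / r"] by (simp add: power_divide)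
  moreover have "\<bar>det B\<bar> * \<bar>det A\<bar> = 1"
    using arg_cong[OF A, of det] by (simp add: det_mul flip: abs_mult)
  ultimately have "1 \<le> \<bar>det B\<bar> * (8 / r\<^sup>2)"
    by (metis abs_ge_zero mult_left_mono)
  then show "r\<^sup>2 \<le> 8 * \<bar>det B\<bar>"
    using r by (simp add: field_simps)
qed

text \<open>Each column of \<open>B\<close> is the difference of the images of two vertices. Both
  lie in a ball of radius \<open>h\<close>, so every entry is at most \<open>2 * h\<close> in
  absolute value.\<close>

lemma det_le_if_image_subset_cball:
  assumes sub: "H_map B d ` ref_triangle \<subseteq> cball z h"
  shows "\<bar>det B\<bar> \<le> 8 * h\<^sup>2"
proof -
  have vertices: "vector [0, 0] \<in> ref_triangle" "vector [1, 0] \<in> ref_triangle" "vector [0, 1] \<in> ref_triangle"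
    by (auto simp: ref_triangle_def ref_vertices_def intro: hull_inc)
  have "axis j 1 + vector [0, 0] \<in> ref_triangle" for j :: 2
  proof -
    have "axis 1 1 + vector [0, 0] = (vector [1, 0] :: real^2)" "axis 2 1 + vector [0, 0] = (vector [0, 1] :: real^2)"
      by (simp_all add: vec_eq_iff forall_2 axis_def)
    then show ?thesis using vertices exhaust_2[of j] by auto
  qed
  then have in_cball: "H_map B d (axis j 1 + vector [0, 0]) \<in> cball z h"
    "H_map B d (vector [0, 0]) \<in> cball z h" for j
    using sub vertices(1) by blast+
  have n: "norm (B *v axis j 1) \<le> 2 * h" for j
  proof -
    have "norm (B *v axis j 1) = dist (H_map B d (axis j 1 + vector [0, 0])) (H_map B d (vector [0, 0]))"
      by (simp add: H_map_def dist_norm matrix_vector_right_distrib)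
    also have "\<dots> \<le> dist z (H_map B d (axis j 1 + vector [0, 0])) + dist z (H_map B d (vector [0, 0]))"
      by (rule dist_triangle3)
    also have "\<dots> \<le> 2 * h"
      using in_cball(1)[of j] in_cball(2) by simp
    finally show ?thesis .
  qed
  have "\<bar>B $ i $ j\<bar> \<le> 2 * h" for i j
    using component_le_norm_cart[of "B *v axis j 1" i] n[of j]
    by (simp add: matrix_vector_mul_component inner_axis)
  from abs_det_2_le[OF this] show ?thesis by (simp add: power2_eq_square)
qed

section \<open>Prisms and their images\<close>

lemma convex_prism: "convex K \<Longrightarrow> convex (prism t0 t1 K)"
  by (simp add: prism_def convex_Times)

lemma bounded_prism: "bounded K \<Longrightarrow> bounded (prism t0 t1 K)"
  by (simp add: prism_def bounded_Times)

text \<open>A convex set is negligible only if its interior is empty, and the open cylinder over the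
  ball lies in the interior of the prism.\<close>

lemma measure_prism_pos:
  assumes "t0 < t1" "convex K" "bounded K" and ball: "0 < r" "cball z r \<subseteq> K"
  shows "0 < measure lebesgue (prism t0 t1 K)"
proof -
  have "{t0<..<t1} \<times> ball z r \<subseteq> interior (prism t0 t1 K)"
    using ball(2) ball_subset_cball[of z r]
    by (intro interior_maximal) (auto simp: prism_def intro: open_Times)
  moreover have "((t0 + t1) / 2, z) \<in> {t0<..<t1} \<times> ball z r"
    using assms by (auto simp: field_simps)
  ultimately have "\<not> negligible (prism t0 t1 K)"
    using assms by (auto simp: negligible_convex_interior convex_prism)
  moreover have "prism t0 t1 K \<in> lmeasurable"
    using assms by (simp add: measurable_convex convex_prism bounded_prism)
  ultimately show ?thesis
    by (simp add: negligible_iff_measure zero_less_measure_iff)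
qed

lemma G_map_prism: "G_map B d ` prism t0 t1 K = prism t0 t1 (H_map B d ` K)"
  by (force simp: G_map_def H_map_def prism_def)

lemma convex_G_map_image: "convex S \<Longrightarrow> convex (G_map B d ` S)"
proof -
  assume S: "convex S"
  have "linear (\<lambda>y :: spacetime. (fst y, B *v snd y))"
    by (auto intro!: linearI simp: matrix_vector_right_distrib matrix_vector_mult_scaleR)
  then have "convex ((\<lambda>y. (0, d) + y) ` (\<lambda>y. (fst y, B *v snd y)) ` S)"
    using S by (intro convex_translation convex_linear_image)
  also have "\<dots> = G_map B d ` S"
    by (simp add: image_image G_map_def add.commute)
  finally show ?thesis .
qed

text \<open>Time differences are unchanged, while spatial ones are stretched by at least
  \<open>r / 2\<close> and at most the operator norm of \<open>B\<close>. Taking \<open>min\<close>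
  and \<open>max\<close> with 1 gives constants valid for both components, which the Euclidean
  product distance then combines.\<close>

lemma G_map_bilipschitz:
  assumes r: "0 < r" "\<And>v. r * norm v \<le> 2 * norm (B *v v)"
  obtains m M where "0 < m" "\<And>y z. m * dist y z \<le> dist (G_map B d y) (G_map B d z)"
    "\<And>y z. dist (G_map B d y) (G_map B d z) \<le> M * dist y z"
proof
  define K where "K = onorm ((*v) B)"
  have K: "norm (B *v v) \<le> K * norm v" for v
    unfolding K_def by (rule onorm[OF matrix_vector_mul_bounded_linear])
  have "0 \<le> K"
    unfolding K_def by (rule onorm_pos_le[OF matrix_vector_mul_bounded_linear])
  have d: "dist (G_map B d y) (G_map B d z) = sqrt ((dist (fst y) (fst z))\<^sup>2 + (norm (B *v (snd y - snd z)))\<^sup>2)"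
    for y z
    by (simp add: G_map_def dist_prod_def dist_norm[of "_ + _"] matrix_vector_mult_diff_distrib)
  show "0 < min 1 (r / 2)" using r by simp
  show "min 1 (r / 2) * dist y z \<le> dist (G_map B d y) (G_map B d z)" for y z
  proof -
    let ?m = "min 1 (r / 2)"
    have m: "0 \<le> ?m" "?m \<le> 1" "?m \<le> r / 2" using r by auto
    have "?m * norm (snd y - snd z) \<le> r / 2 * norm (snd y - snd z)"
      using m by (intro mult_right_mono) auto
    also have "\<dots> \<le> norm (B *v (snd y - snd z))"
      using r(2)[of "snd y - snd z"] by simp
    finally have 2: "?m * dist (snd y) (snd z) \<le> norm (B *v (snd y - snd z))"
      by (simp add: dist_norm)
    have 1: "?m * dist (fst y) (fst z) \<le> dist (fst y) (fst z)"
      using m by (intro mult_left_le_one_le) auto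
    have "?m * dist y z = sqrt ((?m * dist (fst y) (fst z))\<^sup>2 + (?m * dist (snd y) (snd z))\<^sup>2)"
      using m by (simp add: dist_prod_def power_mult_distrib real_sqrt_mult flip: distrib_left)
    also have "\<dots> \<le> dist (G_map B d y) (G_map B d z)"
      unfolding d using 1 2 m by (intro real_sqrt_le_mono add_mono power_mono) auto
    finally show ?thesis .
  qed
  show "dist (G_map B d y) (G_map B d z) \<le> max 1 K * dist y z" for y z
  proof -
    let ?M = "max 1 K"
    have "norm (B *v (snd y - snd z)) \<le> K * dist (snd y) (snd z)"
      using K by (simp add: dist_norm)
    also have "\<dots> \<le> ?M * dist (snd y) (snd z)"
      by (intro mult_right_mono) auto
    finally have 2: "norm (B *v (snd y - snd z)) \<le> ?M * dist (snd y) (snd z)" .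
    have 1: "dist (fst y) (fst z) \<le> ?M * dist (fst y) (fst z)"
      using mult_right_mono[of 1 ?M "dist (fst y) (fst z)"] by simp
    have "dist (G_map B d y) (G_map B d z)
        \<le> sqrt ((?M * dist (fst y) (fst z))\<^sup>2 + (?M * dist (snd y) (snd z))\<^sup>2)"
      unfolding d using 1 2 by (intro real_sqrt_le_mono add_mono power_mono) auto
    also have "\<dots> = ?M * dist y z"
      by (simp add: dist_prod_def power_mult_distrib real_sqrt_mult flip: distrib_left)
    finally show ?thesis .
  qed
qed

section \<open>Uniqueness and pull-back of traces\<close>

lemma L2_integrable:
  assumes "S \<in> lmeasurable" "u \<in> L2 (lebesgue_on S)"
  shows "integrable (lebesgue_on S) u"
  using assms finite_measure_lebesgue_on
  by (auto simp: L2_def intro: finite_measure.square_integrable_imp_integrable)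

text \<open>Pointwise uniqueness of the limit value holds almost everywhere on the face. It
  transfers the estimate from one explicit trace to every trace.\<close>

lemma is_trace_unique:
  assumes D: "convex D" "bounded D" "0 < measure lebesgue D" and M: "space M \<subseteq> D"
    and u: "integrable (lebesgue_on D) u"
    and g: "is_trace D M u g" "is_trace D M u g'"
  shows "AE x in M. g x = g' x"
proof -
  have "AE x in M. (mean_deviation D u (g x) x \<longlongrightarrow> 0) (at_right 0)"
    "AE x in M. (mean_deviation D u (g' x) x \<longlongrightarrow> 0) (at_right 0)"
    using g by (simp_all add: is_trace_def mean_deviation_def[abs_def])
  with AE_space show ?thesis
    by eventually_elim (use mean_deviation_limit_unique[OF D _ u] M in blast)
qed

lemma convex_ref_triangle: "convex ref_triangle"
  by (simp add: ref_triangle_def convex_convex_hull)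

lemma bounded_ref_triangle: "bounded ref_triangle"
  by (simp add: ref_triangle_def ref_vertices_def bounded_convex_hull)

text \<open>Triangles are closed here, so a lateral face consists of points of the prism itself;
  this supplies the membership \<open>x \<in> D\<close> that the convexity bounds ask for.\<close>

lemma lateral_face_subset_prism:
  "convex K \<Longrightarrow> p \<in> K \<Longrightarrow> q \<in> K \<Longrightarrow> lateral_face p q t0 t1 \<subseteq> prism t0 t1 K"
  using closed_segment_subset[of p K q] by (auto simp: lateral_face_def prism_def)

text \<open>The squared norms are in the ratio of the edge lengths, and the assumption on
  \<open>B\<close> bounds that ratio by \<open>2 / r\<close>.\<close>

lemma L2_norm_face_le:
  assumes r: "0 < r" "r * norm (q - p) \<le> 2 * norm (B *v (q - p))" and "p \<noteq> q"
    and g: "g \<in> L2 (face_measure (H_map B d p) (H_map B d q) t0 t1)"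
  shows "g \<circ> G_map B d \<in> L2 (face_measure p q t0 t1)"
    and "r * (L2_norm (face_measure p q t0 t1) (g \<circ> G_map B d))\<^sup>2
       \<le> 2 * (L2_norm (face_measure (H_map B d p) (H_map B d q) t0 t1) g)\<^sup>2"
proof -
  let ?l = "dist p q" and ?L = "dist (H_map B d p) (H_map B d q)"
  let ?n = "(L2_norm (face_measure p q t0 t1) (g \<circ> G_map B d))\<^sup>2"
  let ?N = "(L2_norm (face_measure (H_map B d p) (H_map B d q) t0 t1) g)\<^sup>2"
  have len: "r * ?l \<le> 2 * ?L"
    using r(2) by (simp add: H_map_def dist_norm norm_minus_commute matrix_vector_mult_diff_distrib)
  moreover have l: "0 < ?l" using \<open>p \<noteq> q\<close> by simp
  \<comment> \<open>The same length bound shows that the image edge is nondegenerate, as the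
    comparison of face integrals requires.\<close>
  ultimately have "0 < ?L" using r(1) by (smt (verit) mult_pos_pos)
  then have "H_map B d p \<noteq> H_map B d q" by auto
  note face = face_comp_G_map[OF \<open>p \<noteq> q\<close> this g]
  show "g \<circ> G_map B d \<in> L2 (face_measure p q t0 t1)" by (rule face(1))
  have "?l * (r * ?n) \<le> 2 * ?L * ?n"
    using mult_right_mono[OF len, of ?n] by (simp add: mult_ac)
  also have "\<dots> = ?l * (2 * ?N)"
    using face(2) by simp
  finally show "r * ?n \<le> 2 * ?N"
    using l by simp
qed

text \<open>At each point of the face the limit pulls back by
  \<open>mean_deviation_comp_tendsto\<close>. The exceptional null set pulls back because both face
  measures come from the same parameter rectangle.\<close>

lemma is_trace_comp_G_map:
  assumes B: "invertible B" and r: "0 < r" "\<And>v. r * norm v \<le> 2 * norm (B *v v)"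
    and K: "convex K" "bounded (H_map B d ` K)"
      "0 < measure lebesgue (prism t0 t1 (H_map B d ` K))"
    and u: "integrable (lebesgue_on (prism t0 t1 (H_map B d ` K))) u"
    and pq: "p \<in> K" "q \<in> K" "p \<noteq> q"
    and g: "is_trace (prism t0 t1 (H_map B d ` K)) (face_measure (H_map B d p) (H_map B d q) t0 t1) u g"
  shows "is_trace (prism t0 t1 K) (face_measure p q t0 t1) (u \<circ> G_map B d) (g \<circ> G_map B d)"
proof -
  interpret lebesgue_scaling "G_map B d" "\<bar>det B\<bar>"
    using B by (rule lebesgue_scaling_G_map)
  let ?D = "prism t0 t1 K"
  obtain m M where m: "0 < m" "\<And>y z. m * dist y z \<le> dist (G_map B d y) (G_map B d z)"
    and M: "\<And>y z. dist (G_map B d y) (G_map B d z) \<le> M * dist y z"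
    using G_map_bilipschitz[OF r] by blast
  have D: "convex ?D" "bounded (G_map B d ` ?D)" "0 < measure lebesgue (G_map B d ` ?D)"
    using K by (simp_all add: G_map_prism convex_prism bounded_prism)
  have H: "H_map B d p \<noteq> H_map B d q"
    using inj_matrix_vector_mult[OF B] pq(3) by (auto simp: H_map_def inj_on_def)
  have "AE x in face_measure (H_map B d p) (H_map B d q) t0 t1.
      (mean_deviation (G_map B d ` ?D) u (g x) x \<longlongrightarrow> 0) (at_right 0)"
    using g by (simp add: is_trace_def mean_deviation_def[abs_def] G_map_prism)
  from AE_face_comp_G_map[OF pq(3) H this] AE_space
  have "AE x in face_measure p q t0 t1.
      (mean_deviation ?D (u \<circ> G_map B d) (g (G_map B d x)) x \<longlongrightarrow> 0) (at_right 0)"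
  proof eventually_elim
    case (elim x)
    then have "x \<in> ?D"
      using lateral_face_subset_prism[OF K(1) pq(1,2)] by (auto simp: space_face_measure)
    then show ?case
      using elim u by (intro mean_deviation_comp_tendsto[OF D _ convex_G_map_image m M])
        (simp_all add: G_map_prism)
  qed
  then show ?thesis
    by (simp add: is_trace_def mean_deviation_def[abs_def])
qed

section \<open>The scaling estimates under shape regularity\<close>

theorem lemma4p2:
  fixes c_r :: real
  shows "\<exists>C>0. \<forall>(v1::real^2) v2 v3 z\<^sub>h h\<^sub>K z\<^sub>\<rho> \<rho>\<^sub>K t0 t1 B d st ss u.
    \<not> collinear {v1, v2, v3} \<longrightarrow>
    circumscribed_circle v1 v2 v3 z\<^sub>h h\<^sub>K \<longrightarrow>
    inscribed_circle v1 v2 v3 z\<^sub>\<rho> \<rho>\<^sub>K \<longrightarrow>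
    h\<^sub>K / \<rho>\<^sub>K \<le> c_r \<longrightarrow>
    t0 < t1 \<longrightarrow>
    bij_betw (H_map B d) ref_triangle (triangle v1 v2 v3) \<longrightarrow>
    u \<in> sobolev st ss (prism t0 t1 (triangle v1 v2 v3)) \<longrightarrow>
    (let \<K> = prism t0 t1 (triangle v1 v2 v3);
         \<K>' = prism t0 t1 ref_triangle;
         u' = u \<circ> G_map B d
     in u' \<in> L2 (lebesgue_on \<K>') \<and>
        (L2_norm (lebesgue_on \<K>) u)\<^sup>2 \<le> C * h\<^sub>K\<^sup>2 * (L2_norm (lebesgue_on \<K>') u')\<^sup>2 \<and>
        (L2_norm (lebesgue_on \<K>') u')\<^sup>2 \<le> C / h\<^sub>K\<^sup>2 * (L2_norm (lebesgue_on \<K>) u)\<^sup>2 \<and>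
        (\<forall>p \<in> ref_vertices. \<forall>q \<in> ref_vertices. p \<noteq> q \<longrightarrow>
          (let F' = face_measure p q t0 t1;
               F = face_measure (H_map B d p) (H_map B d q) t0 t1
           in \<forall>g. is_L2_trace \<K> F u g \<longrightarrow>
                (\<exists>g'. is_L2_trace \<K>' F' u' g') \<and>
                (\<forall>g'. is_L2_trace \<K>' F' u' g' \<longrightarrow>
                   (L2_norm F' g')\<^sup>2 \<le> C / h\<^sub>K * (L2_norm F g)\<^sup>2))))"
proof -
  \<comment> \<open>The summands are the constants of the three estimates; the absolute value keeps
    the sum positive before the sign of \<open>c_r\<close> is known.\<close>
  define C where "C = 8 + 8 * c_r\<^sup>2 + 2 * \<bar>c_r\<bar>"
  have C: "8 \<le> C" "8 * c_r\<^sup>2 \<le> C" "2 * c_r \<le> C" "0 < C"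
    using zero_le_power2[of c_r] abs_ge_self[of c_r] unfolding C_def by linarith+
  show ?thesis
  proof (rule exI[of _ C], intro conjI allI impI)
    show "0 < C" by (rule C)
  next
    fix v1 v2 v3 z\<^sub>h :: "real^2" and h\<^sub>K z\<^sub>\<rho> \<rho>\<^sub>K t0 t1 B d st ss u
    assume circ: "circumscribed_circle v1 v2 v3 z\<^sub>h h\<^sub>K"
      and insc: "inscribed_circle v1 v2 v3 z\<^sub>\<rho> \<rho>\<^sub>K"
      and reg: "h\<^sub>K / \<rho>\<^sub>K \<le> c_r"
      and t: "t0 < t1"
      and bij: "bij_betw (H_map B d) ref_triangle (triangle v1 v2 v3)"
      and "u \<in> sobolev st ss (prism t0 t1 (triangle v1 v2 v3))"
    define K where "K = triangle v1 v2 v3"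
    let ?K = "prism t0 t1 K" and ?K' = "prism t0 t1 ref_triangle"
    let ?u' = "u \<circ> G_map B d"
    have HK: "H_map B d ` ref_triangle = K"
      using bij unfolding K_def by (rule bij_betw_imp_surj_on)
    then have GK: "G_map B d ` ?K' = ?K"
      by (simp add: G_map_prism)
    have u: "u \<in> L2 (lebesgue_on ?K)"
      using \<open>u \<in> sobolev _ _ _\<close> by (simp add: sobolev_def K_def)
    have K: "convex K" "bounded K"
      by (simp_all add: K_def triangle_def convex_convex_hull bounded_convex_hull)
    have \<rho>: "0 < \<rho>\<^sub>K" "cball z\<^sub>\<rho> \<rho>\<^sub>K \<subseteq> K"
      using insc by (auto simp: inscribed_circle_def K_def)
    note B = ref_triangle_image_contains_ball[OF \<rho>(1), of z\<^sub>\<rho> B d, unfolded HK, OF \<rho>(2)]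
    have "{v1, v2, v3} \<subseteq> cball z\<^sub>h h\<^sub>K"
      using circ sphere_cball[of z\<^sub>h h\<^sub>K] unfolding circumscribed_circle_def by blast
    then have "K \<subseteq> cball z\<^sub>h h\<^sub>K"
      unfolding K_def triangle_def by (intro hull_minimal convex_cball)
    then have det_le: "\<bar>det B\<bar> \<le> 8 * h\<^sub>K\<^sup>2"
      by (rule det_le_if_image_subset_cball[of B d, unfolded HK])
    \<comment> \<open>A radius of a nonempty sphere is nonnegative; it is not zero because the
      inscribed ball makes the determinant nonzero, while \<open>det_le\<close> bounds it by the
      radius.\<close>
    have h: "0 < h\<^sub>K"
    proof -
      have "0 \<le> h\<^sub>K"
        using circ by (auto simp: circumscribed_circle_def)
      moreover have "0 < \<rho>\<^sub>K\<^sup>2" using \<rho> by simp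
      then have "0 < h\<^sub>K\<^sup>2" using B(3) det_le by linarith
      ultimately show ?thesis by (simp add: less_le)
    qed
    have h_le: "h\<^sub>K \<le> c_r * \<rho>\<^sub>K"
      using reg \<rho>(1) by (simp add: pos_divide_le_eq)
    \<comment> \<open>Shape regularity passes from the outer to the inner radius, whose square the
      determinant controls.\<close>
    have "h\<^sub>K\<^sup>2 \<le> (c_r * \<rho>\<^sub>K)\<^sup>2"
      using h_le h by (intro power_mono) auto
    also have "\<dots> \<le> c_r\<^sup>2 * (8 * \<bar>det B\<bar>)"
      unfolding power_mult_distrib using B(3) by (intro mult_left_mono) auto
    finally have h2_le: "h\<^sub>K\<^sup>2 \<le> 8 * c_r\<^sup>2 * \<bar>det B\<bar>" by simp

    interpret lebesgue_scaling "G_map B d" "\<bar>det B\<bar>"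
      by (rule lebesgue_scaling_G_map[OF B(1)])
    have prisms: "?K' \<in> lmeasurable" "?K \<in> lmeasurable"
      using K by (simp_all add: measurable_convex convex_prism bounded_prism convex_ref_triangle bounded_ref_triangle)
    then have sets: "?K' \<in> sets lebesgue" "G_map B d ` ?K' \<in> sets lebesgue"
      by (simp_all add: GK fmeasurableD)
    have pos: "0 < measure lebesgue ?K"
      using measure_prism_pos[OF t K \<rho>] .
    \<comment> \<open>Positive measure of the reference prism is inherited from its image through
      the determinant factor.\<close>
    then have pos': "0 < measure lebesgue ?K'"
      using measure_image[OF sets] by (simp add: GK zero_less_mult_iff)
    note L2 = L2_comp[OF sets, unfolded GK, OF u]
    let ?N = "(L2_norm (lebesgue_on ?K) u)\<^sup>2" and ?N' = "(L2_norm (lebesgue_on ?K') ?u')\<^sup>2"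
    have 1: "?N \<le> C * h\<^sub>K\<^sup>2 * ?N'"
    proof -
      have "\<bar>det B\<bar> \<le> C * h\<^sub>K\<^sup>2"
        using det_le C(1) by (meson mult_right_mono order_trans zero_le_power2)
      then show ?thesis
        unfolding L2(2) by (intro mult_right_mono) auto
    qed
    have 2: "?N' \<le> C / h\<^sub>K\<^sup>2 * ?N"
    proof -
      have "h\<^sub>K\<^sup>2 * ?N' \<le> 8 * c_r\<^sup>2 * \<bar>det B\<bar> * ?N'"
        using h2_le by (intro mult_right_mono) auto
      also have "\<dots> = 8 * c_r\<^sup>2 * ?N"
        by (simp add: L2(2))
      also have "\<dots> \<le> C * ?N"
        using C(2) by (intro mult_right_mono) auto
      finally show ?thesis
        using h by (simp add: field_simps)
    qed
    have 3: "(\<exists>g'. is_L2_trace ?K' (face_measure p q t0 t1) ?u' g') \<and>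
        (\<forall>g'. is_L2_trace ?K' (face_measure p q t0 t1) ?u' g' \<longrightarrow>
           (L2_norm (face_measure p q t0 t1) g')\<^sup>2
             \<le> C / h\<^sub>K * (L2_norm (face_measure (H_map B d p) (H_map B d q) t0 t1) g)\<^sup>2)"
      if pq: "p \<in> ref_vertices" "q \<in> ref_vertices" "p \<noteq> q"
        and g: "is_L2_trace ?K (face_measure (H_map B d p) (H_map B d q) t0 t1) u g"
      for p q g
    proof -
      let ?F = "face_measure (H_map B d p) (H_map B d q) t0 t1" and ?F' = "face_measure p q t0 t1"
      have vertices: "p \<in> ref_triangle" "q \<in> ref_triangle"
        using pq by (auto simp: ref_triangle_def intro: hull_inc)
      note norm_le = L2_norm_face_le[OF \<rho>(1) B(2) pq(3), of g]
      have gL2: "g \<in> L2 ?F" and tr: "is_trace ?K ?F u g"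
        using g by (auto simp: is_L2_trace_def)
      have "is_trace ?K' ?F' ?u' (g \<circ> G_map B d)"
        using is_trace_comp_G_map[where d = d, OF B(1) \<rho>(1) B(2) convex_ref_triangle, unfolded HK,
            OF K(2) pos L2_integrable[OF prisms(2) u] vertices pq(3) tr] .
      with norm_le(1)[OF gL2] have tr': "is_L2_trace ?K' ?F' ?u' (g \<circ> G_map B d)"
        by (simp add: is_L2_trace_def)
      \<comment> \<open>An arbitrary trace \<open>g'\<close> agrees almost everywhere with the
        pull-back of \<open>g\<close>, so both have the same norm.\<close>
      have "(L2_norm ?F' g')\<^sup>2 \<le> C / h\<^sub>K * (L2_norm ?F g)\<^sup>2" if g': "is_L2_trace ?K' ?F' ?u' g'" for g'
      proof -
        have "AE x in ?F'. g' x = (g \<circ> G_map B d) x"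
        proof (rule is_trace_unique)
          show "convex ?K'" "bounded ?K'"
            by (simp_all add: convex_prism bounded_prism convex_ref_triangle bounded_ref_triangle)
          show "space ?F' \<subseteq> ?K'"
            using lateral_face_subset_prism[OF convex_ref_triangle vertices]
            by (simp add: space_face_measure)
          show "integrable (lebesgue_on ?K') ?u'"
            by (rule L2_integrable[OF prisms(1) L2(1)])
          show "is_trace ?K' ?F' ?u' g'" "is_trace ?K' ?F' ?u' (g \<circ> G_map B d)"
            using g' tr' by (simp_all add: is_L2_trace_def)
        qed (rule pos')
        then have "(LINT x|?F'. (g' x)\<^sup>2) = (LINT x|?F'. ((g \<circ> G_map B d) x)\<^sup>2)"
          using g' tr' by (intro integral_cong_AE) (auto simp: is_L2_trace_def L2_def)
        then have eq: "L2_norm ?F' g' = L2_norm ?F' (g \<circ> G_map B d)"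
          by (simp add: L2_norm_def)
        \<comment> \<open>The positive radii force the sign of \<open>c_r\<close>, which is needed
          to multiply the face estimate by it.\<close>
        have c: "0 \<le> c_r"
          using h_le h \<rho>(1) by (smt (verit) mult_nonpos_nonneg)
        have "h\<^sub>K * (L2_norm ?F' g')\<^sup>2 \<le> c_r * \<rho>\<^sub>K * (L2_norm ?F' g')\<^sup>2"
          using h_le by (intro mult_right_mono) auto
        also have "\<dots> \<le> c_r * (2 * (L2_norm ?F g)\<^sup>2)"
          using mult_left_mono[OF norm_le(2)[OF gL2] c] by (simp add: eq mult.assoc)
        also have "\<dots> \<le> C * (L2_norm ?F g)\<^sup>2"
          using mult_right_mono[OF C(3), of "(L2_norm ?F g)\<^sup>2"] by (simp add: mult_ac)
        finally show ?thesis
          using h by (simp add: field_simps)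
      qed
      with tr' show ?thesis by blast
    qed
    show "let \<K> = prism t0 t1 (triangle v1 v2 v3);
         \<K>' = prism t0 t1 ref_triangle;
         u' = u \<circ> G_map B d
     in u' \<in> L2 (lebesgue_on \<K>') \<and>
        (L2_norm (lebesgue_on \<K>) u)\<^sup>2 \<le> C * h\<^sub>K\<^sup>2 * (L2_norm (lebesgue_on \<K>') u')\<^sup>2 \<and>
        (L2_norm (lebesgue_on \<K>') u')\<^sup>2 \<le> C / h\<^sub>K\<^sup>2 * (L2_norm (lebesgue_on \<K>) u)\<^sup>2 \<and>
        (\<forall>p \<in> ref_vertices. \<forall>q \<in> ref_vertices. p \<noteq> q \<longrightarrow>
          (let F' = face_measure p q t0 t1;
               F = face_measure (H_map B d p) (H_map B d q) t0 t1
           in \<forall>g. is_L2_trace \<K> F u g \<longrightarrow>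
                (\<exists>g'. is_L2_trace \<K>' F' u' g') \<and>
                (\<forall>g'. is_L2_trace \<K>' F' u' g' \<longrightarrow>
                   (L2_norm F' g')\<^sup>2 \<le> C / h\<^sub>K * (L2_norm F g)\<^sup>2)))"
      unfolding Let_def K_def[symmetric] using L2(1) 1 2 3 by blast
  qed
qed

end
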